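(* The probability $P_L$ is the unique probability $P_A$ on $(\Omega,\mathcal{F})$ which satisfies (PN), (PP) and the following condition: for all $B\subset K$, $x\in B$ and $F\in\mathcal{F}_W$, $$P_A(S=x\mid F\cap\{\mathcal{X}=B\})=|B|^{-1}\quad\text{if } P_A(F\cap\{\mathcal{X}=B\})>0.$$
   Context: Setting. $K$ is a finite set with $|K|=M\ge 1$. $(\Omega_O,\mathcal{F}_O,\mathbb{P}_O)$ is a probability space carrying a random variable $\mathcal{X}^O$ with values in the set of all subsets of $K$, and $\mathbb{P}_O(\mathcal{X}^O=\emptyset)<1$. Let $\partial$ be a point not in $K$, $\Omega_A=K\cup\{\partial\}$, $\Omega=\Omega_O\times\Omega_A$, and $S:\Omega\to\Omega_A$, $S((\omega,x))=x$. Let $\mathcal{F}_W=\{F\times\Omega_A: F\in\mathcal{F}_O\}$ and $\mathcal{F}=\sigma(\mathcal{F}_W,S)$. The probability $\mathbb{P}$ on $(\Omega,\mathcal{F}_W)$ is defined by $\mathbb{P}(F\times\Omega_A)=\mathbb{P}_O(F)$. A random variable $Y^O$ on $\Omega_O$ is extended to $\Omega$ by $Y((\omega,x))=Y^O(\omega)$; thus $\mathcal{X}$ is the extension of $\mathcal{X}^O$. Principles, for a probability $P_A$ on $(\Omega,\mathcal{F})$: (PN): (i) if $F\in\mathcal{F}_W$ and $\mathbb{P}(F)=0$ then $P_A(F)=0$; (ii) $P_A(S\in\mathcal{X})=1$. (PP): for all $F\in\mathcal{F}_W$, $P_A(F)=\mathbb{P}(F\mid\mathcal{X}\ne\emptyset)$.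 The measure $P_L$ is the probability on $(\Omega,\mathcal{F})$ determined, for $F\in\mathcal{F}_W$ and $B\subset K$, by $$P_L(F\cap\{\mathcal{X}=B\}\cap\{S=x\})=\begin{cases}|B|^{-1}\,\mathbb{P}(F\cap\{\mathcal{X}=B\}\mid\mathcal{X}\neq\emptyset), & x\in B,\\ 0, & x\notin B.\end{cases}$$ *)

theory Defs
  imports "HOL-Probability.Probability"
begin

text \<open>
  Throughout, \<open>MO\<close> is the probability space \<open>(\<Omega>\<^sub>O, \<F>\<^sub>O, \<P>\<^sub>O)\<close>, \<open>K\<close> the finite set, \<open>d\<close> the extra
  point outside \<open>K\<close>, and \<open>XO\<close> the random subset of \<open>K\<close>.
\<close>

definition OmegaA :: "'a set \<Rightarrow> 'a \<Rightarrow> 'a set" where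
  "OmegaA K d = insert d K"

definition Omega :: "'w measure \<Rightarrow> 'a set \<Rightarrow> 'a \<Rightarrow> ('w \<times> 'a) set" where
  "Omega MO K d = space MO \<times> OmegaA K d"

definition S :: "'w \<times> 'a \<Rightarrow> 'a" where
  "S = (\<lambda>(w, x). x)"

definition ext :: "('w \<Rightarrow> 'b) \<Rightarrow> 'w \<times> 'a \<Rightarrow> 'b" where
  "ext Y = (\<lambda>(w, x). Y w)"

definition F_W :: "'w measure \<Rightarrow> 'a set \<Rightarrow> 'a \<Rightarrow> ('w \<times> 'a) set set" where
  "F_W MO K d = {F \<times> OmegaA K d | F. F \<in> sets MO}"

text \<open>\<open>\<sigma>(\<F>\<^sub>W, S)\<close>, where the finite set \<open>\<Omega>\<^sub>A\<close> carries the \<open>\<sigma>\<close>-algebra of all its subsets.\<close>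

definition F_full :: "'w measure \<Rightarrow> 'a set \<Rightarrow> 'a \<Rightarrow> ('w \<times> 'a) set set" where
  "F_full MO K d = sigma_sets (Omega MO K d)
     (F_W MO K d \<union> {S -` B \<inter> Omega MO K d | B. B \<subseteq> OmegaA K d})"

text \<open>
  The measure \<open>\<P>\<close> on \<open>(\<Omega>, \<F>\<^sub>W)\<close>. As \<open>\<Omega>\<^sub>A\<close> is nonempty, a set \<open>F \<times> \<Omega>\<^sub>A\<close> in \<open>\<F>\<^sub>W\<close> has first projection \<open>F\<close>;
  see \<open>emeasure_P_W\<close> below.
\<close>

definition P_W :: "'w measure \<Rightarrow> 'a set \<Rightarrow> 'a \<Rightarrow> ('w \<times> 'a) measure" where
  "P_W MO K d = measure_of (Omega MO K d) (F_W MO K d) (\<lambda>A. emeasure MO (fst ` A))"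

definition probability_on :: "'b set \<Rightarrow> 'b set set \<Rightarrow> 'b measure \<Rightarrow> bool" where
  "probability_on \<Omega> \<A> Q \<longleftrightarrow> prob_space Q \<and> space Q = \<Omega> \<and> sets Q = \<A>"

definition PN :: "'w measure \<Rightarrow> 'a set \<Rightarrow> 'a \<Rightarrow> ('w \<Rightarrow> 'a set) \<Rightarrow> ('w \<times> 'a) measure \<Rightarrow> bool" where
  "PN MO K d XO PA \<longleftrightarrow>
     (\<forall>F\<in>F_W MO K d. measure (P_W MO K d) F = 0 \<longrightarrow> measure PA F = 0) \<and>
     \<P>(\<omega> in PA. S \<omega> \<in> ext XO \<omega>) = 1"

definition PP :: "'w measure \<Rightarrow> 'a set \<Rightarrow> 'a \<Rightarrow> ('w \<Rightarrow> 'a set) \<Rightarrow> ('w \<times> 'a) measure \<Rightarrow> bool" where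
  "PP MO K d XO PA \<longleftrightarrow>
     (\<forall>F\<in>F_W MO K d. measure PA F = \<P>(\<omega> in P_W MO K d. \<omega> \<in> F \<bar> ext XO \<omega> \<noteq> {}))"

definition is_P_L :: "'w measure \<Rightarrow> 'a set \<Rightarrow> 'a \<Rightarrow> ('w \<Rightarrow> 'a set) \<Rightarrow> ('w \<times> 'a) measure \<Rightarrow> bool" where
  "is_P_L MO K d XO Q \<longleftrightarrow>
     probability_on (Omega MO K d) (F_full MO K d) Q \<and>
     (\<forall>F\<in>F_W MO K d. \<forall>B. B \<subseteq> K \<longrightarrow> (\<forall>x\<in>OmegaA K d.
        \<P>(\<omega> in Q. \<omega> \<in> F \<and> ext XO \<omega> = B \<and> S \<omega> = x) =
          (if x \<in> B
           then 1 / real (card B) *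
                \<P>(\<omega> in P_W MO K d. \<omega> \<in> F \<and> ext XO \<omega> = B \<bar> ext XO \<omega> \<noteq> {})
           else 0)))"

text \<open>Well-definedness of this description is the lemma \<open>ex1_is_P_L\<close> below.\<close>

definition P_L :: "'w measure \<Rightarrow> 'a set \<Rightarrow> 'a \<Rightarrow> ('w \<Rightarrow> 'a set) \<Rightarrow> ('w \<times> 'a) measure" where
  "P_L MO K d XO = (THE Q. is_P_L MO K d XO Q)"


lemma sets_P_W: "sets (P_W MO K d) = F_W MO K d"
  and space_P_W: "space (P_W MO K d) = Omega MO K d"
  and emeasure_P_W: "F \<in> sets MO \<Longrightarrow> emeasure (P_W MO K d) (F \<times> OmegaA K d) = emeasure MO F"
proof -
  have ne: "OmegaA K d \<noteq> {}" by (simp add: OmegaA_def)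
  have sub: "F_W MO K d \<subseteq> Pow (Omega MO K d)"
    using sets.sets_into_space by (fastforce simp: F_W_def Omega_def)
  interpret sigma_algebra "Omega MO K d" "F_W MO K d"
    unfolding sigma_algebra_iff2
  proof (intro conjI ballI allI impI)
    show "F_W MO K d \<subseteq> Pow (Omega MO K d)" by (rule sub)
    show "{} \<in> F_W MO K d" by (auto simp: F_W_def intro!: exI[of _ "{}"])
    fix s assume "s \<in> F_W MO K d"
    then obtain F where "F \<in> sets MO" "s = F \<times> OmegaA K d" by (auto simp: F_W_def)
    then have "Omega MO K d - s = (space MO - F) \<times> OmegaA K d" "space MO - F \<in> sets MO"
      by (auto simp: Omega_def)
    then show "Omega MO K d - s \<in> F_W MO K d"
      unfolding F_W_def by blast
  next
    fix A :: "nat \<Rightarrow> _" assume "range A \<subseteq> F_W MO K d"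
    then have "A i \<in> F_W MO K d" for i by (rule subsetD) simp
    then have "\<forall>i. \<exists>F. F \<in> sets MO \<and> A i = F \<times> OmegaA K d" by (simp add: F_W_def) blast
    then obtain F where "\<And>i. F i \<in> sets MO" "\<And>i. A i = F i \<times> OmegaA K d" by metis
    then have "(\<Union>i. A i) = (\<Union>i. F i) \<times> OmegaA K d" "(\<Union>i. F i) \<in> sets MO"
      by auto
    then show "(\<Union>i. A i) \<in> F_W MO K d"
      unfolding F_W_def by blast
  qed
  show "sets (P_W MO K d) = F_W MO K d" "space (P_W MO K d) = Omega MO K d"
    using sub by (simp_all add: P_W_def sets_measure_of space_measure_of sigma_sets_eq)
  have img: "fst ` (G \<times> OmegaA K d) = G" for G :: "'w set"
    using ne by auto
  have ca: "countably_additive (F_W MO K d) (\<lambda>A. emeasure MO (fst ` A))"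
  proof (rule countably_additiveI)
    fix A :: "nat \<Rightarrow> _" assume r: "range A \<subseteq> F_W MO K d" and disj: "disjoint_family A"
    from r have "A i \<in> F_W MO K d" for i by (rule subsetD) simp
    then have "\<forall>i. \<exists>F. F \<in> sets MO \<and> A i = F \<times> OmegaA K d" by (simp add: F_W_def) blast
    then obtain F where F: "\<And>i. F i \<in> sets MO" "\<And>i. A i = F i \<times> OmegaA K d" by metis
    have "disjoint_family F"
      using disj ne unfolding disjoint_family_on_def F(2) by blast
    moreover have "fst ` (\<Union>i. A i) = (\<Union>i. F i)"
      by (simp add: image_UN F(2) img ne)
    ultimately show "(\<Sum>i. emeasure MO (fst ` A i)) = emeasure MO (fst ` (\<Union>i. A i))"
      using F(1) by (simp add: F(2) img ne suminf_emeasure image_subset_iff)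
  qed
  assume "F \<in> sets MO"
  then have "F \<times> OmegaA K d \<in> F_W MO K d" by (auto simp: F_W_def)
  then show "emeasure (P_W MO K d) (F \<times> OmegaA K d) = emeasure MO F"
    unfolding P_W_def
    by (subst emeasure_measure_of_sigma[OF sigma_algebra_axioms _ ca])
       (auto simp: positive_def img ne)
qed

lemma F_full_generator:
  "F_W MO K d \<union> {S -` B \<inter> Omega MO K d | B. B \<subseteq> OmegaA K d} \<subseteq> Pow (Omega MO K d)"
  using sets.sets_into_space by (fastforce simp: F_W_def Omega_def)

lemma sigma_algebra_F_full: "sigma_algebra (Omega MO K d) (F_full MO K d)"
  unfolding F_full_def by (rule sigma_algebra_sigma_sets[OF F_full_generator])

lemma sets_slice:
  assumes A: "A \<in> F_full MO K d" and x: "x \<in> OmegaA K d"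
  shows "{w\<in>space MO. (w, x) \<in> A} \<in> sets MO"
proof -
  let ?Q = "sigma (Omega MO K d) (F_W MO K d \<union> {S -` B \<inter> Omega MO K d | B. B \<subseteq> OmegaA K d})"
  have Q: "sets ?Q = F_full MO K d"
    unfolding F_full_def by (rule sets_measure_of[OF F_full_generator])
  have "(\<lambda>w. (w, x)) \<in> measurable MO ?Q"
  proof (rule measurable_sigma_sets[OF _ F_full_generator])
    show "sets ?Q = sigma_sets (Omega MO K d)
            (F_W MO K d \<union> {S -` B \<inter> Omega MO K d | B. B \<subseteq> OmegaA K d})"
      by (simp add: Q F_full_def)
    show "(\<lambda>w. (w, x)) \<in> space MO \<rightarrow> Omega MO K d" using x by (auto simp: Omega_def)
    fix y assume "y \<in> F_W MO K d \<union> {S -` B \<inter> Omega MO K d | B. B \<subseteq> OmegaA K d}"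
    then consider F where "F \<in> sets MO" "y = F \<times> OmegaA K d"
      | B where "y = S -` B \<inter> Omega MO K d" by (auto simp: F_W_def)
    then show "(\<lambda>w. (w, x)) -` y \<inter> space MO \<in> sets MO"
    proof cases
      case 1
      then have "(\<lambda>w. (w, x)) -` y \<inter> space MO = F"
        using x sets.sets_into_space by fastforce
      then show ?thesis using 1 by simp
    next
      case 2
      then have "(\<lambda>w. (w, x)) -` y \<inter> space MO = (if x \<in> B then space MO else {})"
        using x by (auto simp: S_def Omega_def)
      then show ?thesis by simp
    qed
  qed
  from measurable_sets[OF this, of A] A
  have "(\<lambda>w. (w, x)) -` A \<inter> space MO \<in> sets MO" by (simp add: Q)
  then show ?thesis by (simp add: vimage_def Int_def conj_commute)
qed

lemma measure_F_full_decompose: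
  assumes "finite K" and XO: "XO \<in> measurable MO (count_space (Pow K))"
    and Q: "probability_on (Omega MO K d) (F_full MO K d) Q" and A: "A \<in> F_full MO K d"
  shows "measure Q A = (\<Sum>(B, x)\<in>Pow K \<times> OmegaA K d.
           \<P>(\<omega> in Q. \<omega> \<in> {w\<in>space MO. (w, x) \<in> A} \<times> OmegaA K d \<and> ext XO \<omega> = B \<and> S \<omega> = x))"
proof -
  interpret prob_space Q using Q by (simp add: probability_on_def)
  have sp: "space Q = Omega MO K d" "sets Q = F_full MO K d"
    using Q by (simp_all add: probability_on_def)
  note slice = sets_slice[OF A]
  define c where "c = (\<lambda>(B, x). {\<omega>\<in>space Q. \<omega> \<in> {w\<in>space MO. (w, x) \<in> A} \<times> OmegaA K d \<and>
                        ext XO \<omega> = B \<and> S \<omega> = x})"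
  have AO: "A \<subseteq> Omega MO K d" using A sets.sets_into_space[of A Q] sp by simp
  have "A = (\<Union>p\<in>Pow K \<times> OmegaA K d. c p)"
  proof (intro equalityI subsetI)
    fix p assume p: "p \<in> A"
    then have "p \<in> Omega MO K d" using AO by auto
    moreover from this have "XO (fst p) \<subseteq> K"
      using measurable_space[OF XO, of "fst p"] by (auto simp: Omega_def)
    ultimately have "p \<in> c (XO (fst p), snd p)" "(XO (fst p), snd p) \<in> Pow K \<times> OmegaA K d"
      using p by (auto simp: c_def Omega_def ext_def S_def sp)
    then show "p \<in> (\<Union>p\<in>Pow K \<times> OmegaA K d. c p)" by blast
  qed (auto simp: c_def S_def)
  moreover have "c p \<in> sets Q" if "p \<in> Pow K \<times> OmegaA K d" for p
  proof -
    obtain B x where p: "p = (B, x)" "B \<subseteq> K" "x \<in> OmegaA K d" using \<open>p \<in> _\<close> by auto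
    let ?G = "{w\<in>space MO. (w, x) \<in> A} \<inter> (XO -` {B} \<inter> space MO)"
    have "?G \<in> sets MO"
      using slice[OF p(3)] measurable_sets[OF XO, of "{B}"] p(2) by auto
    then have "?G \<times> OmegaA K d \<in> F_W MO K d" by (auto simp: F_W_def)
    then have 1: "?G \<times> OmegaA K d \<in> sets Q" by (simp add: sp F_full_def)
    have 2: "S -` {x} \<inter> Omega MO K d \<in> sets Q"
      unfolding sp F_full_def using p(3) by (intro sigma_sets.Basic) blast
    have "c p = (?G \<times> OmegaA K d) \<inter> (S -` {x} \<inter> Omega MO K d)"
      by (auto simp: c_def p(1) sp Omega_def ext_def S_def)
    then show ?thesis using 1 2 by simp
  qed
  moreover have "disjoint_family_on c (Pow K \<times> OmegaA K d)"
    by (auto simp: disjoint_family_on_def c_def)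
  moreover have "finite (Pow K \<times> OmegaA K d)" using \<open>finite K\<close> by (simp add: OmegaA_def)
  ultimately have "measure Q A = (\<Sum>p\<in>Pow K \<times> OmegaA K d. measure Q (c p))"
    using finite_measure_finite_Union[of "Pow K \<times> OmegaA K d" c] by (simp add: image_subset_iff)
  then show "measure Q A = (\<Sum>(B, x)\<in>Pow K \<times> OmegaA K d.
      \<P>(\<omega> in Q. \<omega> \<in> {w\<in>space MO. (w, x) \<in> A} \<times> OmegaA K d \<and> ext XO \<omega> = B \<and> S \<omega> = x))"
    by (simp add: c_def case_prod_beta)
qed

lemma ex1_is_P_L:
  fixes XO :: "'w \<Rightarrow> 'a set"
  assumes fin: "finite K" and "prob_space MO"
    and XO: "XO \<in> measurable MO (count_space (Pow K))"
    and lt1: "\<P>(w in MO. XO w = {}) < 1"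
  shows "\<exists>!Q. is_P_L MO K d XO Q"
proof (rule ex_ex1I)
  interpret MO: prob_space MO by fact
  define E where "E B = XO -` {B} \<inter> space MO" for B
  have E[measurable]: "E B \<in> sets MO" if "B \<subseteq> K" for B
    unfolding E_def using measurable_sets[OF XO, of "{B}"] that by simp
  have XK: "XO w \<subseteq> K" if "w \<in> space MO" for w
    using measurable_space[OF XO that] by auto
  define N where "N = space MO - E {}"
  have N[measurable]: "N \<in> sets MO" by (simp add: N_def E)
  have "{w\<in>space MO. XO w = {}} = E {}" by (auto simp: E_def)
  then have "measure MO N > 0"
    using lt1 MO.prob_compl[OF E, of "{}"] by (simp add: N_def)
  then have N0: "emeasure MO N \<noteq> 0" by (auto simp: measure_def)
  define R where "R = uniform_measure MO N"
  interpret R: prob_space R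
    unfolding R_def by (rule prob_space_uniform_measure[OF N0]) simp
  have sR[simp]: "sets R = sets MO" and spR[simp]: "space R = space MO" by (simp_all add: R_def)
  have PW: "\<P>(\<omega> in P_W MO K d. \<omega> \<in> G \<times> OmegaA K d \<and> ext XO \<omega> = B \<bar> ext XO \<omega> \<noteq> {})
      = measure R (G \<inter> E B)" if G: "G \<in> sets MO" and B: "B \<subseteq> K" for G B
  proof -
    have G': "G \<subseteq> space MO" using G by (rule sets.sets_into_space)
    let ?H = "N \<inter> (G \<inter> E B)"
    have 1: "{\<omega> \<in> space (P_W MO K d). (\<omega> \<in> G \<times> OmegaA K d \<and> ext XO \<omega> = B) \<and> ext XO \<omega> \<noteq> {}}
        = ?H \<times> OmegaA K d"
      using G' by (auto simp: space_P_W Omega_def ext_def E_def N_def)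
    have 2: "{\<omega> \<in> space (P_W MO K d). ext XO \<omega> \<noteq> {}} = N \<times> OmegaA K d"
      by (auto simp: space_P_W Omega_def ext_def E_def N_def)
    have H: "?H \<in> sets MO" using G E[OF B] N by simp
    have GE: "G \<inter> E B \<in> sets MO" using G E[OF B] by simp
    have "measure R (G \<inter> E B) = measure MO ?H / measure MO N"
      unfolding R_def using measure_uniform_measure[OF N0 _ GE] by simp
    then show ?thesis
      unfolding cond_prob_def 1 2 by (simp add: measure_def emeasure_P_W[OF H] emeasure_P_W[OF N])
  qed
  define I where "I = (SIGMA B:Pow K. B)"
  have finI: "finite I"
    unfolding I_def using fin by (intro finite_SigmaI) (auto intro: finite_subset)
  define sl where "sl A x = {w\<in>space MO. (w, x) \<in> A}" for A :: "('w \<times> 'a) set" and x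
  have sl: "sl A x \<in> sets MO" if "A \<in> F_full MO K d" "x \<in> K" for A x
    unfolding sl_def using sets_slice[OF that(1)] that(2) by (simp add: OmegaA_def)
  define \<mu> where "\<mu> A = (\<Sum>(B, x)\<in>I. ennreal (1 / real (card B)) * emeasure R (sl A x \<inter> E B))"
    for A :: "('w \<times> 'a) set"
  have ca: "countably_additive (F_full MO K d) \<mu>"
  proof (rule countably_additiveI)
    fix A :: "nat \<Rightarrow> ('w \<times> 'a) set"
    assume r: "range A \<subseteq> F_full MO K d" and disj: "disjoint_family A"
    have "(\<Sum>i. emeasure R (sl (A i) x \<inter> E B)) = emeasure R (sl (\<Union>i. A i) x \<inter> E B)"
      if "B \<subseteq> K" "x \<in> B" for B x
    proof -
      have "range (\<lambda>i. sl (A i) x \<inter> E B) \<subseteq> sets R"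
        using r subsetD[OF that] that(2) E[OF that(1)] by (auto simp: image_subset_iff intro!: sl)
      moreover have "disjoint_family (\<lambda>i. sl (A i) x \<inter> E B)"
        using disj unfolding disjoint_family_on_def sl_def by blast
      ultimately have "(\<Sum>i. emeasure R (sl (A i) x \<inter> E B))
          = emeasure R (\<Union>i. sl (A i) x \<inter> E B)"
        by (rule suminf_emeasure)
      also have "(\<Union>i. sl (A i) x \<inter> E B) = sl (\<Union>i. A i) x \<inter> E B"
        by (auto simp: sl_def)
      finally show ?thesis .
    qed
    then have "(\<Sum>p\<in>I. \<Sum>i. (case p of (B, x) \<Rightarrow>
          ennreal (1 / real (card B)) * emeasure R (sl (A i) x \<inter> E B))) = \<mu> (\<Union>i. A i)"
      unfolding \<mu>_def by (intro sum.cong refl) (auto simp: I_def)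
    then show "(\<Sum>i. \<mu> (A i)) = \<mu> (\<Union>i. A i)"
      unfolding \<mu>_def by (subst suminf_sum) simp_all
  qed
  have pos: "positive (F_full MO K d) \<mu>" by (simp add: positive_def \<mu>_def sl_def)
  define Q where "Q = measure_of (Omega MO K d) (F_full MO K d) \<mu>"
  interpret FF: sigma_algebra "Omega MO K d" "F_full MO K d" by (rule sigma_algebra_F_full)
  have Q: "space Q = Omega MO K d" "sets Q = F_full MO K d"
    using FF.space_closed by (simp_all add: Q_def space_measure_of sets_measure_of FF.sigma_sets_eq)
  have em: "emeasure Q A = \<mu> A" if "A \<in> F_full MO K d" for A
    unfolding Q_def by (rule emeasure_measure_of_sigma[OF FF.sigma_algebra_axioms pos ca that])
  have RE0: "emeasure R (E {}) = 0"
  proof -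
    have "N \<inter> E {} = {}" by (auto simp: N_def)
    then show ?thesis
      unfolding R_def using E[of "{}"] N by (simp add: emeasure_uniform_measure)
  qed
  have "\<mu> (Omega MO K d) = (\<Sum>(B, x)\<in>I. ennreal (1 / real (card B)) * emeasure R (E B))"
    unfolding \<mu>_def
  proof (intro sum.cong refl, clarify)
    fix B x assume "(B, x) \<in> I"
    then have "sl (Omega MO K d) x \<inter> E B = E B"
      by (auto simp: I_def sl_def Omega_def OmegaA_def E_def)
    then show "ennreal (1 / real (card B)) * emeasure R (sl (Omega MO K d) x \<inter> E B) =
      ennreal (1 / real (card B)) * emeasure R (E B)" by simp
  qed
  also have "\<dots> = (\<Sum>B\<in>Pow K. \<Sum>x\<in>B. ennreal (1 / real (card B)) * emeasure R (E B))"
    unfolding I_def using fin by (subst sum.Sigma) (auto intro: finite_subset)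
  also have "\<dots> = (\<Sum>B\<in>Pow K. emeasure R (E B))"
  proof (intro sum.cong refl)
    fix B assume "B \<in> Pow K"
    then have "finite B" using fin by (auto intro: finite_subset)
    show "(\<Sum>x\<in>B. ennreal (1 / real (card B)) * emeasure R (E B)) = emeasure R (E B)"
    proof (cases "B = {}")
      case False
      then have "card B > 0" using \<open>finite B\<close> by (simp add: card_gt_0_iff)
      then have "of_nat (card B) * ennreal (1 / real (card B)) = 1"
        by (simp add: ennreal_of_nat_eq_real_of_nat flip: ennreal_mult')
      then show ?thesis by (simp flip: mult.assoc)
    qed (simp add: RE0)
  qed
  also have "\<dots> = emeasure R (\<Union>B\<in>Pow K. E B)"
    using fin E by (intro sum_emeasure) (auto simp: disjoint_family_on_def E_def)
  also have "(\<Union>B\<in>Pow K. E B) = space R"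
    using XK by (auto simp: E_def)
  finally have "emeasure Q (space Q) = 1"
    using em[OF FF.top] Q R.emeasure_space_1 by simp
  then have pQ: "prob_space Q" by (rule prob_spaceI)
  show "\<exists>Q. is_P_L MO K d XO Q"
  proof (rule exI[of _ Q], unfold is_P_L_def, intro conjI ballI allI impI)
    show "probability_on (Omega MO K d) (F_full MO K d) Q"
      using pQ Q by (simp add: probability_on_def)
    fix F B x assume "F \<in> F_W MO K d" and B: "B \<subseteq> K" and x: "x \<in> OmegaA K d"
    then obtain G where G: "G \<in> sets MO" and F: "F = G \<times> OmegaA K d" by (auto simp: F_W_def)
    have G': "G \<subseteq> space MO" using G by (rule sets.sets_into_space)
    let ?A = "{\<omega> \<in> space Q. \<omega> \<in> F \<and> ext XO \<omega> = B \<and> S \<omega> = x}"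
    have "(G \<inter> E B) \<times> OmegaA K d \<in> F_W MO K d" using G E[OF B] by (auto simp: F_W_def)
    then have 1: "(G \<inter> E B) \<times> OmegaA K d \<in> F_full MO K d"
      unfolding F_full_def by (intro sigma_sets.Basic UnI1)
    have 2: "S -` {x} \<inter> Omega MO K d \<in> F_full MO K d"
      unfolding F_full_def using x by (intro sigma_sets.Basic UnI2 CollectI exI[of _ "{x}"]) simp
    have "?A = ((G \<inter> E B) \<times> OmegaA K d) \<inter> (S -` {x} \<inter> Omega MO K d)"
      using G' by (auto simp: F Q Omega_def ext_def S_def E_def)
    then have A: "?A \<in> F_full MO K d" using 1 2 by (simp add: FF.Int)
    have "\<mu> ?A = (\<Sum>p\<in>I. if p = (B, x) then
        ennreal (1 / real (card B)) * emeasure R (G \<inter> E B) else 0)"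
      unfolding \<mu>_def
    proof (intro sum.cong refl, clarify)
      fix C y assume "(C, y) \<in> I"
      have "sl ?A y \<inter> E C = (if (C, y) = (B, x) then G \<inter> E B else {})"
        using G' x by (auto simp: sl_def Q F Omega_def ext_def S_def E_def)
      then show "ennreal (1 / real (card C)) * emeasure R (sl ?A y \<inter> E C) = (if (C, y) = (B, x) then
        ennreal (1 / real (card B)) * emeasure R (G \<inter> E B) else 0)" by auto
    qed
    also have "\<dots> = (if x \<in> B then ennreal (1 / real (card B)) * emeasure R (G \<inter> E B) else 0)"
      using finI B by (simp add: I_def)
    also have "\<dots> = (if x \<in> B then ennreal (1 / real (card B) * measure R (G \<inter> E B)) else 0)"
      by (simp add: R.emeasure_eq_measure flip: ennreal_mult')
    finally have "measure Q ?A = (if x \<in> B then 1 / real (card B) * measure R (G \<inter> E B) else 0)"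
      using em[OF A] by (simp add: measure_def del: times_divide_eq_left)
    then show "measure Q ?A = (if x \<in> B
       then 1 / real (card B) * \<P>(\<omega> in P_W MO K d. \<omega> \<in> F \<and> ext XO \<omega> = B \<bar> ext XO \<omega> \<noteq> {})
       else 0)"
      unfolding F PW[OF G B] by simp
  qed
next
  fix Q Q' assume Q: "is_P_L MO K d XO Q" and Q': "is_P_L MO K d XO Q'"
  then have pr: "probability_on (Omega MO K d) (F_full MO K d) Q"
    "probability_on (Omega MO K d) (F_full MO K d) Q'" by (simp_all add: is_P_L_def)
  interpret Q: prob_space Q using pr by (simp add: probability_on_def)
  interpret Q': prob_space Q' using pr by (simp add: probability_on_def)
  have eq: "\<P>(\<omega> in Q. \<omega> \<in> F \<and> ext XO \<omega> = B \<and> S \<omega> = x) = \<P>(\<omega> in Q'. \<omega> \<in> F \<and> ext XO \<omega> = B \<and> S \<omega> = x)"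
    if "F \<in> F_W MO K d" "B \<subseteq> K" "x \<in> OmegaA K d" for F B x
    using Q Q' that unfolding is_P_L_def by simp
  show "Q = Q'"
  proof (rule measure_eqI)
    show "sets Q = sets Q'" using pr by (simp add: probability_on_def)
    fix A assume "A \<in> sets Q"
    then have A: "A \<in> F_full MO K d" using pr by (simp add: probability_on_def)
    have "measure Q A = measure Q' A"
      unfolding measure_F_full_decompose[OF fin XO pr(1) A]
        measure_F_full_decompose[OF fin XO pr(2) A]
    proof (intro sum.cong refl, clarify)
      fix B x assume B: "B \<subseteq> K" and x: "x \<in> OmegaA K d"
      have "{w\<in>space MO. (w, x) \<in> A} \<times> OmegaA K d \<in> F_W MO K d"
        unfolding F_W_def using sets_slice[OF A x] by blast
      then show "\<P>(\<omega> in Q. \<omega> \<in> {w\<in>space MO. (w, x) \<in> A} \<times> OmegaA K d \<and> ext XO \<omega> = B \<and> S \<omega> = x)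
        = \<P>(\<omega> in Q'. \<omega> \<in> {w\<in>space MO. (w, x) \<in> A} \<times> OmegaA K d \<and> ext XO \<omega> = B \<and> S \<omega> = x)"
        using B x by (intro eq) auto
    qed
    then show "emeasure Q A = emeasure Q' A"
      by (simp add: Q.emeasure_eq_measure Q'.emeasure_eq_measure)
  qed
qed

corollary is_P_L_P_L:
  assumes "finite K" "prob_space MO" "XO \<in> measurable MO (count_space (Pow K))"
    and "\<P>(w in MO. XO w = {}) < 1"
  shows "is_P_L MO K d XO (P_L MO K d XO)"
  unfolding P_L_def by (rule theI', rule ex1_is_P_L[OF assms])

end

theory Submission
  imports Defs
begin

text \<open>
  A probability on \<open>\<F>\<close> is pinned down by the masses of the cells
  \<open>F \<inter> {\<X> = B} \<inter> {S = x}\<close> with \<open>F \<in> \<F>\<^sub>W\<close>, and \<open>P\<^sub>L\<close> is by construction the only one with the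
  prescribed cell masses (\<open>ex1_is_P_L\<close>). So it is enough to show that the three conditions on
  \<open>P\<^sub>A\<close> say exactly that the cell masses are the prescribed ones.

  Suppose the conditions hold. As \<open>F \<inter> {\<X> = B}\<close> lies in \<open>\<F>\<^sub>W\<close>, (PP) gives its mass. The
  uniformity condition splits this mass equally among the cells with \<open>x \<in> B\<close> (when the mass
  vanishes, so do the cells), and (PN)(ii) makes the cells with \<open>x \<notin> B\<close> null
  (\<open>is_P_L_if_principles\<close>).

  Conversely, suppose the cell masses are the prescribed ones. Summing over \<open>x\<close> recovers (PP) on the sets
  \<open>F \<inter> {\<X> = B}\<close>: \<open>card B\<close> equal shares make up the whole if \<open>B \<noteq> {}\<close>, and for \<open>B = {}\<close> both sides
  are zero since the conditioning excludes \<open>\<X> = {}\<close> (\<open>is_P_L_level\<close>). Summing over \<open>B\<close> then gives (PP) itself,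
  because conditional probability is additive (\<open>is_P_L_PP\<close>). Uniformity is the ratio of a cell
  mass to the mass of \<open>F \<inter> {\<X> = B}\<close>; (PN)(i) follows from (PP) by absolute continuity of
  conditioning, and (PN)(ii) holds since \<open>{S \<notin> \<X>}\<close> is a finite union of null cells.
\<close>

section \<open>Events determined by the random set and the sample\<close>

lemma Omega_in_F_W: "Omega MO K d \<in> F_W MO K d"
  unfolding F_W_def Omega_def by blast

lemma F_W_subset_F_full: "F_W MO K d \<subseteq> F_full MO K d"
  unfolding F_full_def by auto

lemma F_W_subset_Omega: "F \<in> F_W MO K d \<Longrightarrow> F \<subseteq> Omega MO K d"
  using sets.sets_into_space by (fastforce simp: F_W_def Omega_def)

lemma ext_in_Pow:
  assumes "XO \<in> measurable MO (count_space (Pow K))" "\<omega> \<in> Omega MO K d"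
  shows "ext XO \<omega> \<in> Pow K"
  using measurable_space[OF assms(1), of "fst \<omega>"] assms(2)
  by (auto simp: Omega_def ext_def split: prod.splits)

lemma S_in_OmegaA: "\<omega> \<in> Omega MO K d \<Longrightarrow> S \<omega> \<in> OmegaA K d"
  by (auto simp: Omega_def S_def)

lemma random_set_event_in_F_W:
  fixes XO :: "'w \<Rightarrow> 'a set"
  assumes XO: "XO \<in> measurable MO (count_space (Pow K))" and F: "F \<in> F_W MO K d"
  shows "{\<omega> \<in> Omega MO K d. \<omega> \<in> F \<and> P (ext XO \<omega>)} \<in> F_W MO K d"
proof -
  obtain G where G: "G \<in> sets MO" "F = G \<times> OmegaA K d" using F by (auto simp: F_W_def)
  let ?H = "G \<inter> (XO -` {B \<in> Pow K. P B} \<inter> space MO)"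
  have "?H \<in> sets MO"
    using G(1) by (intro sets.Int measurable_sets[OF XO]) auto
  moreover have "{\<omega> \<in> Omega MO K d. \<omega> \<in> F \<and> P (ext XO \<omega>)} = ?H \<times> OmegaA K d"
    using measurable_space[OF XO] by (auto simp: G(2) Omega_def ext_def)
  ultimately show ?thesis by (auto simp: F_W_def)
qed

text \<open>
  \<open>S\<close> has finitely many values, and once \<open>S = x\<close> is fixed a joint condition on \<open>\<X>\<close> and \<open>S\<close> becomes
  one on \<open>\<X>\<close> alone. With \<open>F = \<Omega>\<close> this covers \<open>{S \<in> \<X>}\<close>.
\<close>

lemma joint_event_in_F_full:
  fixes XO :: "'w \<Rightarrow> 'a set"
  assumes fin: "finite K" and XO: "XO \<in> measurable MO (count_space (Pow K))"
    and F: "F \<in> F_W MO K d"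
  shows "{\<omega> \<in> Omega MO K d. \<omega> \<in> F \<and> P (ext XO \<omega>) (S \<omega>)} \<in> F_full MO K d"
proof -
  interpret sigma_algebra "Omega MO K d" "F_full MO K d" by (rule sigma_algebra_F_full)
  have "{\<omega> \<in> Omega MO K d. \<omega> \<in> F \<and> P (ext XO \<omega>) (S \<omega>)} =
      (\<Union>x\<in>OmegaA K d. {\<omega> \<in> Omega MO K d. \<omega> \<in> F \<and> P (ext XO \<omega>) x} \<inter> (S -` {x} \<inter> Omega MO K d))"
    by (auto dest: S_in_OmegaA)
  also have "\<dots> \<in> F_full MO K d"
  proof (rule finite_UN)
    show "finite (OmegaA K d)" using fin by (simp add: OmegaA_def)
    fix x assume x: "x \<in> OmegaA K d"
    have "{\<omega> \<in> Omega MO K d. \<omega> \<in> F \<and> P (ext XO \<omega>) x} \<in> F_full MO K d"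
      by (rule subsetD[OF F_W_subset_F_full random_set_event_in_F_W[OF XO F]])
    moreover have "S -` {x} \<inter> Omega MO K d \<in> F_full MO K d"
      unfolding F_full_def using x by (intro sigma_sets.Basic) blast
    ultimately show "{\<omega> \<in> Omega MO K d. \<omega> \<in> F \<and> P (ext XO \<omega>) x} \<inter> (S -` {x} \<inter> Omega MO K d)
        \<in> F_full MO K d" by (rule Int)
  qed
  finally show ?thesis .
qed

text \<open>
  Stated for any finite measure defined at least on \<open>\<F>\<^sub>W\<close>: the additivity argument for (PP) needs
  it both for a measure on \<open>\<F>\<close> and for \<open>\<P>\<close>, which lives on \<open>\<F>\<^sub>W\<close> only.
\<close>

lemma measure_split_random_set:
  fixes XO :: "'w \<Rightarrow> 'a set"
  assumes fin: "finite K" and XO: "XO \<in> measurable MO (count_space (Pow K))"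
    and M: "finite_measure M" "space M = Omega MO K d" "F_W MO K d \<subseteq> sets M"
    and F: "F \<in> F_W MO K d"
  shows "measure M F = (\<Sum>B\<in>Pow K. \<P>(\<omega> in M. \<omega> \<in> F \<and> ext XO \<omega> = B))"
proof -
  interpret finite_measure M by (rule M(1))
  have "\<omega> \<in> space M \<and> ext XO \<omega> \<subseteq> K" if "\<omega> \<in> F" for \<omega>
  proof -
    have "\<omega> \<in> Omega MO K d" using F_W_subset_Omega[OF F] that by (rule subsetD)
    then show ?thesis using ext_in_Pow[OF XO] by (simp add: M(2))
  qed
  then have "F = (\<Union>B\<in>Pow K. {\<omega> \<in> space M. \<omega> \<in> F \<and> ext XO \<omega> = B})" by auto
  moreover have "measure M (\<Union>B\<in>Pow K. {\<omega> \<in> space M. \<omega> \<in> F \<and> ext XO \<omega> = B})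
      = (\<Sum>B\<in>Pow K. \<P>(\<omega> in M. \<omega> \<in> F \<and> ext XO \<omega> = B))"
  proof (rule finite_measure_finite_Union)
    show "(\<lambda>B. {\<omega> \<in> space M. \<omega> \<in> F \<and> ext XO \<omega> = B}) ` Pow K \<subseteq> sets M"
      using random_set_event_in_F_W[OF XO F, of "\<lambda>C. C = B" for B] M(2,3) by auto
  qed (use fin in \<open>auto simp: disjoint_family_on_def\<close>)
  ultimately show ?thesis by simp
qed

lemma measure_split_sample:
  fixes XO :: "'w \<Rightarrow> 'a set"
  assumes fin: "finite K" and XO: "XO \<in> measurable MO (count_space (Pow K))"
    and Q: "probability_on (Omega MO K d) (F_full MO K d) Q"
    and F: "F \<in> F_W MO K d"
  shows "\<P>(\<omega> in Q. \<omega> \<in> F \<and> ext XO \<omega> = B)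
      = (\<Sum>x\<in>OmegaA K d. \<P>(\<omega> in Q. \<omega> \<in> F \<and> ext XO \<omega> = B \<and> S \<omega> = x))"
proof -
  interpret prob_space Q using Q by (simp add: probability_on_def)
  have sp: "space Q = Omega MO K d" "sets Q = F_full MO K d"
    using Q by (simp_all add: probability_on_def)
  have "{\<omega> \<in> space Q. \<omega> \<in> F \<and> ext XO \<omega> = B}
      = (\<Union>x\<in>OmegaA K d. {\<omega> \<in> space Q. \<omega> \<in> F \<and> ext XO \<omega> = B \<and> S \<omega> = x})"
    by (auto simp: sp(1) dest: S_in_OmegaA)
  moreover have "measure Q (\<Union>x\<in>OmegaA K d. {\<omega> \<in> space Q. \<omega> \<in> F \<and> ext XO \<omega> = B \<and> S \<omega> = x})
      = (\<Sum>x\<in>OmegaA K d. \<P>(\<omega> in Q. \<omega> \<in> F \<and> ext XO \<omega> = B \<and> S \<omega> = x))"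
  proof (rule finite_measure_finite_Union)
    show "(\<lambda>x. {\<omega> \<in> space Q. \<omega> \<in> F \<and> ext XO \<omega> = B \<and> S \<omega> = x}) ` OmegaA K d \<subseteq> sets Q"
      using joint_event_in_F_full[OF fin XO F, of "\<lambda>C y. C = B \<and> y = x" for x] sp by auto
  qed (use fin in \<open>auto simp: OmegaA_def disjoint_family_on_def\<close>)
  ultimately show ?thesis by simp
qed

section \<open>From the principles to the masses of the cells\<close>

text \<open>
  The prescribed masses condition on the two conjuncts \<open>\<omega> \<in> F\<close> and \<open>\<X> = B\<close>, whereas (PP) speaks of
  membership in one set of \<open>\<F>\<^sub>W\<close>; this bridges the two forms.
\<close>

lemma PP_level:
  fixes XO :: "'w \<Rightarrow> 'a set"
  assumes XO: "XO \<in> measurable MO (count_space (Pow K))"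
    and sp: "space Q = Omega MO K d"
    and PP: "PP MO K d XO Q" and F: "F \<in> F_W MO K d"
  shows "\<P>(\<omega> in Q. \<omega> \<in> F \<and> ext XO \<omega> = B)
      = \<P>(\<omega> in P_W MO K d. \<omega> \<in> F \<and> ext XO \<omega> = B \<bar> ext XO \<omega> \<noteq> {})"
proof -
  let ?E = "{\<omega> \<in> Omega MO K d. \<omega> \<in> F \<and> ext XO \<omega> = B}"
  have "measure Q ?E = \<P>(\<omega> in P_W MO K d. \<omega> \<in> ?E \<bar> ext XO \<omega> \<noteq> {})"
    using PP random_set_event_in_F_W[OF XO F, of "\<lambda>C. C = B"] unfolding PP_def by blast
  moreover have "{\<omega> \<in> space (P_W MO K d). \<omega> \<in> ?E \<and> ext XO \<omega> \<noteq> {}}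
      = {\<omega> \<in> space (P_W MO K d). (\<omega> \<in> F \<and> ext XO \<omega> = B) \<and> ext XO \<omega> \<noteq> {}}"
    by (auto simp: space_P_W)
  ultimately show ?thesis
    by (simp add: cond_prob_def sp)
qed

text \<open>
  For \<open>x \<in> B\<close> the cell mass comes from the uniformity condition, or from monotonicity where that
  condition is silent because \<open>F \<inter> {\<X> = B}\<close> is null; for \<open>x \<notin> B\<close> the cell lies in
  \<open>{S \<notin> \<X>}\<close>, a null set.
\<close>

lemma is_P_L_if_principles:
  fixes XO :: "'w \<Rightarrow> 'a set"
  assumes fin: "finite K" and XO: "XO \<in> measurable MO (count_space (Pow K))"
    and Q: "probability_on (Omega MO K d) (F_full MO K d) Q"
    and PN: "PN MO K d XO Q" and PP: "PP MO K d XO Q"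
    and unif: "\<And>B x F. \<lbrakk>B \<subseteq> K; x \<in> B; F \<in> F_W MO K d;
        \<P>(\<omega> in Q. \<omega> \<in> F \<and> ext XO \<omega> = B) > 0\<rbrakk> \<Longrightarrow>
        \<P>(\<omega> in Q. S \<omega> = x \<bar> \<omega> \<in> F \<and> ext XO \<omega> = B) = 1 / real (card B)"
  shows "is_P_L MO K d XO Q"
proof -
  interpret prob_space Q using Q by (simp add: probability_on_def)
  have sp: "space Q = Omega MO K d" "sets Q = F_full MO K d"
    using Q by (simp_all add: probability_on_def)
  have "\<P>(\<omega> in Q. \<omega> \<in> F \<and> ext XO \<omega> = B \<and> S \<omega> = x) =
      (if x \<in> B
       then 1 / real (card B) *
            \<P>(\<omega> in P_W MO K d. \<omega> \<in> F \<and> ext XO \<omega> = B \<bar> ext XO \<omega> \<noteq> {})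
       else 0)" (is "?cell = _")
    if F: "F \<in> F_W MO K d" and B: "B \<subseteq> K" and x: "x \<in> OmegaA K d" for F B x
  proof (cases "x \<in> B")
    case True
    let ?p = "\<P>(\<omega> in Q. \<omega> \<in> F \<and> ext XO \<omega> = B)"
    have level: "{\<omega> \<in> space Q. \<omega> \<in> F \<and> ext XO \<omega> = B} \<in> sets Q"
      using joint_event_in_F_full[OF fin XO F, of "\<lambda>C y. C = B"] by (simp add: sp)
    have "?cell = 1 / real (card B) * ?p"
    proof (cases "?p > 0")
      case True
      have "{\<omega> \<in> space Q. S \<omega> = x \<and> \<omega> \<in> F \<and> ext XO \<omega> = B}
          = {\<omega> \<in> space Q. \<omega> \<in> F \<and> ext XO \<omega> = B \<and> S \<omega> = x}" by auto
      then have "?cell / ?p = 1 / real (card B)"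
        using unif[OF B \<open>x \<in> B\<close> F True] by (simp add: cond_prob_def)
      then show ?thesis using True by (simp add: field_simps)
    next
      case False
      then have "?p = 0" using measure_nonneg[of Q] by (simp add: not_less antisym)
      moreover have "?cell \<le> ?p" by (rule finite_measure_mono[OF _ level]) auto
      ultimately show ?thesis using measure_nonneg[of Q] by (simp add: antisym)
    qed
    then show ?thesis using True PP_level[OF XO sp(1) PP F] by simp
  next
    case False
    have "{\<omega> \<in> space Q. S \<omega> \<in> ext XO \<omega>} \<in> sets Q"
      using joint_event_in_F_full[OF fin XO Omega_in_F_W, where P = "\<lambda>C y. y \<in> C"]
      by (simp add: sp)
    then have "AE \<omega> in Q. S \<omega> \<in> ext XO \<omega>"
      using PN prob_Collect_eq_1 by (simp add: PN_def)
    then have "AE \<omega> in Q. \<not> (\<omega> \<in> F \<and> ext XO \<omega> = B \<and> S \<omega> = x)"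
      by eventually_elim (use False in auto)
    moreover have "{\<omega> \<in> space Q. \<omega> \<in> F \<and> ext XO \<omega> = B \<and> S \<omega> = x} \<in> sets Q"
      using joint_event_in_F_full[OF fin XO F, of "\<lambda>C y. C = B \<and> y = x"] by (simp add: sp)
    ultimately have "?cell = 0" by (simp only: prob_Collect_eq_0)
    then show ?thesis using False by simp
  qed
  then show ?thesis using Q unfolding is_P_L_def by blast
qed

section \<open>From the masses of the cells to the principles\<close>

text \<open>
  Summing the cells over the points of \<open>B\<close> adds up \<open>card B\<close> equal shares. The empty set has to be
  treated apart: there the sum is empty, and the conditional probability vanishes as well.
\<close>

lemma is_P_L_level:
  fixes XO :: "'w \<Rightarrow> 'a set"
  assumes fin: "finite K" and XO: "XO \<in> measurable MO (count_space (Pow K))"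
    and Q: "is_P_L MO K d XO Q" and F: "F \<in> F_W MO K d" and B: "B \<subseteq> K"
  shows "\<P>(\<omega> in Q. \<omega> \<in> F \<and> ext XO \<omega> = B)
      = \<P>(\<omega> in P_W MO K d. \<omega> \<in> F \<and> ext XO \<omega> = B \<bar> ext XO \<omega> \<noteq> {})" (is "_ = ?c")
proof -
  have pr: "probability_on (Omega MO K d) (F_full MO K d) Q" using Q by (simp add: is_P_L_def)
  have finB: "finite B" using fin B by (rule finite_subset[rotated])
  have finA: "finite (OmegaA K d)" using fin by (simp add: OmegaA_def)
  have BA: "OmegaA K d \<inter> B = B" using B by (auto simp: OmegaA_def)
  have "\<P>(\<omega> in Q. \<omega> \<in> F \<and> ext XO \<omega> = B)
      = (\<Sum>x\<in>OmegaA K d. if x \<in> B then 1 / real (card B) * ?c else 0)"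
    unfolding measure_split_sample[OF fin XO pr F]
    using Q F B by (intro sum.cong refl) (simp add: is_P_L_def)
  also have "\<dots> = (\<Sum>x\<in>B. 1 / real (card B) * ?c)"
    using sum.inter_restrict[OF finA, of "\<lambda>x. 1 / real (card B) * ?c" B] BA by simp
  also have "\<dots> = ?c"
  proof (cases "B = {}")
    case True
    have "{\<omega> \<in> space (P_W MO K d). (\<omega> \<in> F \<and> ext XO \<omega> = B) \<and> ext XO \<omega> \<noteq> {}} = {}"
      using True by auto
    then have "?c = 0" by (simp only: cond_prob_def) simp
    then show ?thesis using True by simp
  next
    case False
    then show ?thesis using finB by simp
  qed
  finally show ?thesis .
qed

text \<open>
  (PP) is already known on each \<open>F \<inter> {\<X> = B}\<close>. Both sides of (PP) are additive over the finitely
  many values of \<open>\<X>\<close>; for the conditional probability this is additivity of \<open>\<P>\<close> on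
  \<open>F \<inter> {\<X> \<noteq> {}}\<close>, divided by the constant \<open>\<P>(\<X> \<noteq> {})\<close>.
\<close>

lemma is_P_L_PP:
  fixes XO :: "'w \<Rightarrow> 'a set"
  assumes fin: "finite K" and MO: "prob_space MO"
    and XO: "XO \<in> measurable MO (count_space (Pow K))"
    and Q: "is_P_L MO K d XO Q"
  shows "PP MO K d XO Q"
  unfolding PP_def
proof
  fix F assume F: "F \<in> F_W MO K d"
  interpret MO: prob_space MO by (rule MO)
  interpret Q: prob_space Q using Q by (simp add: is_P_L_def probability_on_def)
  have sp: "space Q = Omega MO K d" "sets Q = F_full MO K d"
    using Q by (simp_all add: is_P_L_def probability_on_def)
  let ?W = "P_W MO K d"
  have fW: "finite_measure ?W"
    by (rule finite_measureI)
       (simp add: space_P_W Omega_def emeasure_P_W MO.emeasure_space_1)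
  let ?n = "\<P>(\<omega> in ?W. ext XO \<omega> \<noteq> {})"
  let ?FN = "{\<omega> \<in> space ?W. \<omega> \<in> F \<and> ext XO \<omega> \<noteq> {}}"
  have FN: "?FN \<in> F_W MO K d"
    using random_set_event_in_F_W[OF XO F, of "\<lambda>C. C \<noteq> {}"] by (simp add: space_P_W)
  have "measure Q F = (\<Sum>B\<in>Pow K. \<P>(\<omega> in Q. \<omega> \<in> F \<and> ext XO \<omega> = B))"
    using F_W_subset_F_full sp
    by (intro measure_split_random_set[OF fin XO Q.finite_measure_axioms _ _ F]) simp_all
  also have "\<dots> = (\<Sum>B\<in>Pow K. \<P>(\<omega> in ?W. \<omega> \<in> F \<and> ext XO \<omega> = B \<bar> ext XO \<omega> \<noteq> {}))"
    using is_P_L_level[OF fin XO Q F] by (intro sum.cong) auto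
  also have "\<dots> = (\<Sum>B\<in>Pow K. \<P>(\<omega> in ?W. \<omega> \<in> ?FN \<and> ext XO \<omega> = B) / ?n)"
    unfolding cond_prob_def
    by (intro sum.cong refl arg_cong[of _ _ "\<lambda>A. measure ?W A / ?n"]) auto
  also have "\<dots> = measure ?W ?FN / ?n"
    using measure_split_random_set[OF fin XO fW space_P_W _ FN]
    by (simp add: sets_P_W sum_divide_distrib)
  finally show "measure Q F = \<P>(\<omega> in ?W. \<omega> \<in> F \<bar> ext XO \<omega> \<noteq> {})"
    by (simp add: cond_prob_def)
qed

text \<open>
  Part (i) is a consequence of (PP), since conditioning on an event is absolutely continuous. For
  part (ii), \<open>{S \<notin> \<X>}\<close> is covered by the finitely many null cells \<open>{\<X> = B} \<inter> {S = x}\<close> with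
  \<open>x \<notin> B\<close>.
\<close>

lemma is_P_L_PN:
  fixes XO :: "'w \<Rightarrow> 'a set"
  assumes fin: "finite K" and MO: "prob_space MO"
    and XO: "XO \<in> measurable MO (count_space (Pow K))"
    and Q: "is_P_L MO K d XO Q"
  shows "PN MO K d XO Q"
  unfolding PN_def
proof (intro conjI ballI impI)
  interpret MO: prob_space MO by (rule MO)
  interpret Q: prob_space Q using Q by (simp add: is_P_L_def probability_on_def)
  have sp: "space Q = Omega MO K d" "sets Q = F_full MO K d"
    using Q by (simp_all add: is_P_L_def probability_on_def)
  let ?W = "P_W MO K d"
  interpret W: finite_measure ?W
    by (rule finite_measureI)
       (simp add: space_P_W Omega_def emeasure_P_W MO.emeasure_space_1)
  {
    fix F assume F: "F \<in> F_W MO K d" and 0: "measure ?W F = 0"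
    have "\<P>(\<omega> in ?W. \<omega> \<in> F \<and> ext XO \<omega> \<noteq> {}) \<le> measure ?W F"
      using F by (intro W.finite_measure_mono) (auto simp: sets_P_W)
    then have "\<P>(\<omega> in ?W. \<omega> \<in> F \<and> ext XO \<omega> \<noteq> {}) = 0"
      using 0 measure_nonneg[of ?W] by (simp add: antisym)
    then show "measure Q F = 0"
      using is_P_L_PP[OF fin MO XO Q] F by (simp add: PP_def cond_prob_def)
  }
  have "AE \<omega> in Q. \<not> (ext XO \<omega> = B \<and> S \<omega> = x)"
    if B: "B \<subseteq> K" and x: "x \<in> OmegaA K d" "x \<notin> B" for B x
  proof -
    have "\<P>(\<omega> in Q. \<omega> \<in> Omega MO K d \<and> ext XO \<omega> = B \<and> S \<omega> = x) = 0"
      using Q B x Omega_in_F_W[of MO K d] unfolding is_P_L_def by simp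
    moreover have "{\<omega> \<in> space Q. ext XO \<omega> = B \<and> S \<omega> = x} \<in> sets Q"
      using joint_event_in_F_full[OF fin XO Omega_in_F_W, where P = "\<lambda>C y. C = B \<and> y = x"]
      by (simp add: sp)
    ultimately show ?thesis
      using Q.prob_Collect_eq_0[of "\<lambda>\<omega>. ext XO \<omega> = B \<and> S \<omega> = x"] by (simp add: sp)
  qed
  moreover have "finite (Pow K)" "finite (OmegaA K d - B)" for B
    using fin by (simp_all add: OmegaA_def)
  ultimately have "AE \<omega> in Q. \<forall>B\<in>Pow K. \<forall>x\<in>OmegaA K d - B. \<not> (ext XO \<omega> = B \<and> S \<omega> = x)"
    by (intro AE_finite_allI) simp_all
  then have "AE \<omega> in Q. S \<omega> \<in> ext XO \<omega>"
    using AE_space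
  proof eventually_elim
    fix \<omega> assume "\<forall>B\<in>Pow K. \<forall>x\<in>OmegaA K d - B. \<not> (ext XO \<omega> = B \<and> S \<omega> = x)"
      and "\<omega> \<in> space Q"
    then show "S \<omega> \<in> ext XO \<omega>"
      using ext_in_Pow[OF XO, of \<omega> d] S_in_OmegaA[of \<omega> MO K d] by (auto simp: sp(1))
  qed
  moreover have "{\<omega> \<in> space Q. S \<omega> \<in> ext XO \<omega>} \<in> sets Q"
    using joint_event_in_F_full[OF fin XO Omega_in_F_W, where P = "\<lambda>C y. y \<in> C"]
    by (simp add: sp)
  ultimately show "\<P>(\<omega> in Q. S \<omega> \<in> ext XO \<omega>) = 1"
    by (simp add: Q.prob_Collect_eq_1)
qed

lemma is_P_L_uniform:
  fixes XO :: "'w \<Rightarrow> 'a set"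
  assumes fin: "finite K" and XO: "XO \<in> measurable MO (count_space (Pow K))"
    and Q: "is_P_L MO K d XO Q" and F: "F \<in> F_W MO K d" and B: "B \<subseteq> K" and x: "x \<in> B"
    and pos: "\<P>(\<omega> in Q. \<omega> \<in> F \<and> ext XO \<omega> = B) > 0"
  shows "\<P>(\<omega> in Q. S \<omega> = x \<bar> \<omega> \<in> F \<and> ext XO \<omega> = B) = 1 / real (card B)"
proof -
  have "{\<omega> \<in> space Q. S \<omega> = x \<and> \<omega> \<in> F \<and> ext XO \<omega> = B}
      = {\<omega> \<in> space Q. \<omega> \<in> F \<and> ext XO \<omega> = B \<and> S \<omega> = x}" by auto
  moreover have "\<P>(\<omega> in Q. \<omega> \<in> F \<and> ext XO \<omega> = B \<and> S \<omega> = x)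
      = 1 / real (card B) * \<P>(\<omega> in Q. \<omega> \<in> F \<and> ext XO \<omega> = B)"
    unfolding is_P_L_level[OF fin XO Q F B]
    using Q F B x subsetD[OF B x] by (simp add: is_P_L_def OmegaA_def)
  ultimately show ?thesis
    using pos by (simp add: cond_prob_def)
qed

section \<open>The characterization\<close>

theorem proposition2p8:
  fixes MO :: "'w measure" and K :: "'a set" and d :: 'a and XO :: "'w \<Rightarrow> 'a set"
    and PA :: "('w \<times> 'a) measure"
  assumes "finite K" and "card K \<ge> 1" and "d \<notin> K"
    and "prob_space MO"
    and "XO \<in> measurable MO (count_space (Pow K))"
    and "\<P>(w in MO. XO w = {}) < 1"
  shows "(probability_on (Omega MO K d) (F_full MO K d) PA \<and>
      PN MO K d XO PA \<and> PP MO K d XO PA \<and>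
      (\<forall>B. B \<subseteq> K \<longrightarrow> (\<forall>x\<in>B. \<forall>F\<in>F_W MO K d.
         \<P>(\<omega> in PA. \<omega> \<in> F \<and> ext XO \<omega> = B) > 0 \<longrightarrow>
         \<P>(\<omega> in PA. S \<omega> = x \<bar> \<omega> \<in> F \<and> ext XO \<omega> = B) = 1 / real (card B))))
    \<longleftrightarrow> PA = P_L MO K d XO"
    (is "?principles \<longleftrightarrow> _")
proof -
  have "?principles \<longleftrightarrow> is_P_L MO K d XO PA"
  proof
    assume ?principles
    then show "is_P_L MO K d XO PA"
      by (intro is_P_L_if_principles[OF assms(1,5)]) blast+
  next
    assume Q: "is_P_L MO K d XO PA"
    then have "probability_on (Omega MO K d) (F_full MO K d) PA"
      by (simp add: is_P_L_def)
    then show ?principles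
      using is_P_L_PN[OF assms(1,4,5) Q] is_P_L_PP[OF assms(1,4,5) Q]
        is_P_L_uniform[OF assms(1,5) Q] by blast
  qed
  also have "\<dots> \<longleftrightarrow> PA = P_L MO K d XO"
    using ex1_is_P_L[OF assms(1,4,5,6)] is_P_L_P_L[OF assms(1,4,5,6)] by blast
  finally show ?thesis .
qed

end
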